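(* Let $\rho$ be a density operator on $\mathbb{C}^2\otimes\mathbb{C}^2$, and put $a_i=\mathrm{Tr}(\rho\,\sigma_i\otimes\mathbf 1)$, $b_i=\mathrm{Tr}(\rho\,\mathbf 1\otimes\sigma_i)$, $c_{ij}=\mathrm{Tr}(\rho\,\sigma_i\otimes\sigma_j)$ for $i,j\in\{1,2,3\}$, with $a^2=\sum_i a_i^2$ and $b^2=\sum_i b_i^2$. Suppose $$\sum_{i,j=1}^3 c_{ij}^2>1-(b^2-a^2).$$ Then: (1) $(\mathbf 1\otimes T)\rho$ is an entanglement witness for the state $(\mathbf 1\otimes\sigma_y)\,\rho\,(\mathbf 1\otimes\sigma_y)$; (2) $(\mathbf 1\otimes\Lambda_{\mathrm{red}})\rho=\rho^1\otimes\mathbf 1-\rho$ is an entanglement witness for $\rho$ itself, where $\rho^1$ is the reduced density operator of the first system.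
   Context: $\sigma_1,\sigma_2,\sigma_3$ are the Pauli matrices $\sigma_x,\sigma_y,\sigma_z$. A density operator is a positive semidefinite operator of trace one. $\rho$ is separable if $\rho=\sum_k\lambda_k\,\rho^1_k\otimes\rho^2_k$ with $\lambda_k\ge0$, $\sum_k\lambda_k=1$ and density operators $\rho^1_k,\rho^2_k$ on $\mathbb{C}^2$; otherwise it is entangled. A Hermitian operator $W$ on $\mathbb{C}^2\otimes\mathbb{C}^2$ is an entanglement witness for an entangled state $\tau$ if $\mathrm{Tr}(W\omega)\ge 0$ for every separable density operator $\omega$ and $\mathrm{Tr}(W\tau)<0$ (so in particular the claim includes that the named states are entangled). $T$ is matrix transposition in the standard basis of $\mathbb{C}^2$ (the eigenbasis of $\sigma_z$), acting on the second factor by $(\mathbf 1\otimes T)(X\otimes Y)=X\otimes Y^{\mathrm T}$, extended linearly. The reduction map is $\Lambda_{\mathrm{red}}(A)=\mathbf 1\,\mathrm{Tr}(A)-A$ on operators on $\mathbb{C}^2$, and $\mathbf 1\otimes\Lambda_{\mathrm{red}}$ applies it to the second factor. *)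

theory Defs
  imports "HOL-Analysis.Analysis"
begin

text \<open>
  Operators on $\mathbb{C}^n$ are complex matrices indexed by a finite type, and operators on
  $\mathbb{C}^m \otimes \mathbb{C}^n$ are matrices indexed by the product type, whose element
  \<open>(i, k)\<close> stands for the product basis vector $e_i \otimes e_k$.
\<close>

definition adjoint_mat :: "complex^'n^'n \<Rightarrow> complex^'n^'n" where
  "adjoint_mat A = (\<chi> i j. cnj (A $ j $ i))"

definition hermitian :: "complex^'n^'n \<Rightarrow> bool" where
  "hermitian A \<longleftrightarrow> adjoint_mat A = A"

definition cinner :: "complex^'n \<Rightarrow> complex^'n \<Rightarrow> complex" where
  "cinner u v = (\<Sum>i\<in>UNIV. cnj (u $ i) * v $ i)"

definition pos_semidef :: "complex^'n^'n \<Rightarrow> bool" where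
  "pos_semidef A \<longleftrightarrow> hermitian A \<and> (\<forall>v. 0 \<le> Re (cinner v (A *v v)))"

definition density_op :: "complex^'n^'n \<Rightarrow> bool" where
  "density_op A \<longleftrightarrow> pos_semidef A \<and> trace A = 1"

definition tensor_op ::
    "complex^'m^'m \<Rightarrow> complex^'n^'n \<Rightarrow> complex^('m \<times> 'n)^('m \<times> 'n)" (infixr "\<otimes>" 75) where
  "A \<otimes> B = (\<chi> p q. A $ fst p $ fst q * B $ snd p $ snd q)"

definition separable :: "complex^('m::finite \<times> 'n::finite)^('m \<times> 'n) \<Rightarrow> bool" where
  "separable \<rho> \<longleftrightarrow>
    (\<exists>(N::nat) (lam :: nat \<Rightarrow> real) (\<rho>1 :: nat \<Rightarrow> complex^'m^'m) (\<rho>2 :: nat \<Rightarrow> complex^'n^'n).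
      (\<forall>k<N. 0 \<le> lam k \<and> density_op (\<rho>1 k) \<and> density_op (\<rho>2 k)) \<and>
      (\<Sum>k<N. lam k) = 1 \<and>
      \<rho> = (\<Sum>k<N. lam k *\<^sub>R (\<rho>1 k \<otimes> \<rho>2 k)))"

definition entangled :: "complex^('m::finite \<times> 'n::finite)^('m \<times> 'n) \<Rightarrow> bool" where
  "entangled \<rho> \<longleftrightarrow> density_op \<rho> \<and> \<not> separable \<rho>"

text \<open>
  The real part in \<open>expval\<close> only changes the type: the trace is real whenever both
  operators are Hermitian (lemma \<open>of_real_expval\<close>), which is the case in every use below.
\<close>

definition expval :: "complex^'n^'n \<Rightarrow> complex^'n^'n \<Rightarrow> real" where
  "expval A B = Re (trace (A ** B))"

definition entanglement_witness ::
    "complex^('m::finite \<times> 'n::finite)^('m \<times> 'n) \<Rightarrow> complex^('m \<times> 'n)^('m \<times> 'n) \<Rightarrow> bool" where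
  "entanglement_witness W \<tau> \<longleftrightarrow>
    hermitian W \<and> entangled \<tau> \<and>
    (\<forall>\<omega>. density_op \<omega> \<and> separable \<omega> \<longrightarrow> 0 \<le> expval W \<omega>) \<and>
    expval W \<tau> < 0"

definition sigma_x :: "complex^2^2" where
  "sigma_x = vector [vector [0, 1], vector [1, 0]]"

definition sigma_y :: "complex^2^2" where
  "sigma_y = vector [vector [0, - \<i>], vector [\<i>, 0]]"

definition sigma_z :: "complex^2^2" where
  "sigma_z = vector [vector [1, 0], vector [0, - 1]]"

definition pauli :: "3 \<Rightarrow> complex^2^2" where
  "pauli i = (vector [sigma_x, sigma_y, sigma_z] :: complex^2^2^3) $ i"

text \<open>
  Writing \<open>X\<close> as the sum of $E_{ij} \otimes X_{ij}$ over the matrix units $E_{ij}$ of the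
  first factor, \<open>snd_factor_map F\<close>, i.e. $\mathbf{1} \otimes F$, replaces each block
  $X_{ij}$ by $F(X_{ij})$.
\<close>

definition op_block :: "'m::finite \<Rightarrow> 'm \<Rightarrow> complex^('m \<times> 'n::finite)^('m \<times> 'n) \<Rightarrow> complex^'n^'n" where
  "op_block i j X = (\<chi> k l. X $ (i, k) $ (j, l))"

definition snd_factor_map ::
    "(complex^'n^'n \<Rightarrow> complex^'n^'n) \<Rightarrow>
     complex^('m::finite \<times> 'n::finite)^('m \<times> 'n) \<Rightarrow> complex^('m \<times> 'n)^('m \<times> 'n)" where
  "snd_factor_map F X = (\<chi> p q. F (op_block (fst p) (fst q) X) $ snd p $ snd q)"

definition reduction_map :: "complex^2^2 \<Rightarrow> complex^2^2" where
  "reduction_map A = mat (trace A) - A"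

definition reduced_fst :: "complex^('m::finite \<times> 'n::finite)^('m \<times> 'n) \<Rightarrow> complex^'m^'m" where
  "reduced_fst X = (\<chi> i j. \<Sum>k\<in>UNIV. X $ (i, k) $ (j, k))"

lemma of_real_expval:
  assumes "hermitian A" "hermitian B"
  shows "complex_of_real (expval A B) = trace (A ** B)"
proof -
  have A: "cnj (A $ i $ j) = A $ j $ i" for i j
    using assms(1) unfolding hermitian_def adjoint_mat_def by (metis vec_lambda_beta)
  have B: "cnj (B $ i $ j) = B $ j $ i" for i j
    using assms(2) unfolding hermitian_def adjoint_mat_def by (metis vec_lambda_beta)
  have "cnj (trace (A ** B)) = trace (A ** B)"
    unfolding trace_def matrix_matrix_mult_def
    by (simp add: A B) (rule sum.swap)
  then show ?thesis
    unfolding expval_def by (metis Reals_cnj_iff of_real_Re)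
qed

text \<open>
  The next three facts determine \<open>snd_factor_map transpose\<close> and
  \<open>snd_factor_map reduction_map\<close>, since every operator is a sum of product operators.
\<close>

lemma snd_factor_map_add:
  assumes "\<And>A B. F (A + B) = F A + F B"
  shows "snd_factor_map F (X + Y) = snd_factor_map F X + snd_factor_map F Y"
proof -
  have "op_block i j (X + Y) = op_block i j X + op_block i j Y" for i j
    by (simp add: op_block_def vec_eq_iff)
  then have "F (op_block i j (X + Y)) = F (op_block i j X) + F (op_block i j Y)" for i j
    by (simp only: assms)
  then show ?thesis
    by (simp add: snd_factor_map_def vec_eq_iff)
qed

lemma snd_factor_map_transpose_tensor:
  "snd_factor_map transpose (A \<otimes> B) = A \<otimes> transpose B"
  by (simp add: snd_factor_map_def op_block_def tensor_op_def transpose_def vec_eq_iff)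

lemma snd_factor_map_reduction_tensor:
  "snd_factor_map reduction_map (A \<otimes> B) = A \<otimes> reduction_map B"
  by (simp add: snd_factor_map_def op_block_def tensor_op_def reduction_map_def trace_def mat_def
      vec_eq_iff sum_distrib_left algebra_simps)

lemma reduced_fst_tensor:
  "trace B = 1 \<Longrightarrow> reduced_fst (A \<otimes> B) = A"
  by (simp add: reduced_fst_def tensor_op_def trace_def vec_eq_iff flip: sum_distrib_left)

end

theory Submission
  imports Defs
begin

text \<open>
  Conjugation by \<open>\<sigma>\<^sub>y\<close> turns transposition of 2 by 2 matrices into the reduction map, so
  \<open>1 \<otimes> \<Lambda>\<close> and \<open>1 \<otimes> T\<close> applied to \<open>\<rho>\<close> differ only by the local unitary \<open>1 \<otimes> \<sigma>\<^sub>y\<close>, and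
  both claims reduce to one inequality:
  \<open>4 Tr ((\<rho>\<^sub>1 \<otimes> 1 - \<rho>) \<rho>) = 1 + a\<^sup>2 - b\<^sup>2 - \<Sum> c\<^sub>i\<^sub>j\<^sup>2 < 0\<close>. Nonnegativity on product states holds because
  moving \<open>T\<close> onto the second factor leaves \<open>Tr (\<rho> (A \<otimes> B\<^sup>T))\<close>, and positive 2 by 2
  matrices are sums of rank-one ones.
\<close>

section \<open>Rank-one operators, the trace pairing and tensor products\<close>

definition ket_bra :: "complex^'n \<Rightarrow> complex^'n^'n" where
  "ket_bra v = (\<chi> i j. v $ i * cnj (v $ j))"

lemma hermitian_iff: "hermitian A \<longleftrightarrow> (\<forall>i j. cnj (A $ j $ i) = A $ i $ j)"
  by (simp add: hermitian_def adjoint_mat_def vec_eq_iff)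

lemma hermitian_cnj: "hermitian A \<Longrightarrow> cnj (A $ i $ j) = A $ j $ i"
  by (simp add: hermitian_iff)

text \<open>A quadratic form becomes a trace pairing with a rank-one operator, so cyclicity of the
  trace can act on it.\<close>

lemma cinner_eq_expval_ket_bra: "Re (cinner v (A *v v)) = expval A (ket_bra v)"
  by (simp add: cinner_def expval_def trace_def matrix_matrix_mult_def matrix_vector_mult_def
      ket_bra_def sum_distrib_left mult_ac)

lemma tensor_ket_bra: "ket_bra v \<otimes> ket_bra w = ket_bra (\<chi> p. v $ fst p * w $ snd p)"
  by (simp add: ket_bra_def tensor_op_def vec_eq_iff)

lemma expval_add: "expval W (A + B) = expval W A + expval W B"
  by (simp add: expval_def matrix_add_ldistrib trace_add)

lemma expval_scaleR: "expval W (r *\<^sub>R A) = r * expval W A"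
  by (simp add: expval_def trace_def matrix_matrix_mult_def sum_distrib_left)

lemma expval_sum: "expval W (sum f S) = (\<Sum>k\<in>S. expval W (f k))"
proof (induction S rule: infinite_finite_induct)
  case (insert x F)
  then show ?case by (simp add: expval_add)
qed (simp_all add: expval_def trace_def matrix_matrix_mult_def)

lemma expval_conjugate: "expval (U ** A ** V) B = expval A (V ** B ** U)"
proof -
  have "trace (U ** (A ** V ** B)) = trace ((A ** V ** B) ** U)"
    by (rule trace_mul_sym)
  then show ?thesis
    by (simp add: expval_def matrix_mul_assoc)
qed

lemma tensor_add_left: "(A + B) \<otimes> C = A \<otimes> C + B \<otimes> C"
  by (simp add: tensor_op_def vec_eq_iff algebra_simps)

lemma tensor_add_right: "A \<otimes> (B + C) = A \<otimes> B + A \<otimes> C"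
  by (simp add: tensor_op_def vec_eq_iff algebra_simps)

lemma tensor_mult: "(A \<otimes> B) ** (C \<otimes> D) = (A ** C) \<otimes> (B ** D)"
  by (simp add: tensor_op_def matrix_matrix_mult_def vec_eq_iff sum_product sum.cartesian_product
      case_prod_unfold mult_ac)

lemma mat_tensor_mat: "mat 1 \<otimes> mat 1 = mat 1"
  by (auto simp: tensor_op_def mat_def vec_eq_iff prod_eq_iff)

lemma adjoint_mat_mult: "adjoint_mat (A ** B) = adjoint_mat B ** adjoint_mat A"
  by (simp add: adjoint_mat_def matrix_matrix_mult_def vec_eq_iff mult.commute)

lemma ket_bra_conjugate: "U ** ket_bra v ** adjoint_mat U = ket_bra (U *v v)"
  by (simp add: ket_bra_def adjoint_mat_def matrix_matrix_mult_def matrix_vector_mult_def vec_eq_iff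
      sum_distrib_left sum_distrib_right mult_ac)

section \<open>Positive semidefinite matrices and their rank-one decomposition in dimension
  two\<close>

lemma pos_semidef_conjugate:
  assumes "hermitian U" "pos_semidef A"
  shows "pos_semidef (U ** A ** U)"
  unfolding pos_semidef_def
proof (intro conjI allI)
  have U: "adjoint_mat U = U"
    using assms(1) by (simp add: hermitian_def)
  have A: "adjoint_mat A = A"
    using assms(2) by (simp add: pos_semidef_def hermitian_def)
  show "hermitian (U ** A ** U)"
    by (simp add: hermitian_def adjoint_mat_mult U A matrix_mul_assoc)
  fix v
  have "Re (cinner v ((U ** A ** U) *v v)) = expval A (U ** ket_bra v ** U)"
    by (simp add: cinner_eq_expval_ket_bra expval_conjugate)
  \<comment> \<open>Since \<open>U\<close> is self-adjoint, \<open>U ** ket_bra v ** U\<close> is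
    the rank-one operator of \<open>U *v v\<close>.\<close>
  also have "\<dots> = Re (cinner (U *v v) (A *v (U *v v)))"
    using ket_bra_conjugate[of U v] by (simp add: U cinner_eq_expval_ket_bra)
  also have "\<dots> \<ge> 0"
    using assms(2) by (simp add: pos_semidef_def)
  finally show "0 \<le> Re (cinner v ((U ** A ** U) *v v))" .
qed

lemma pos_semidef_transpose:
  assumes "pos_semidef A"
  shows "pos_semidef (transpose A)"
  unfolding pos_semidef_def
proof (intro conjI allI)
  show "hermitian (transpose A)"
    using assms by (simp add: pos_semidef_def hermitian_iff transpose_def)
  fix v
  \<comment> \<open>Exchanging the two summation indices undoes the transposition at the cost of
    conjugating the vector.\<close>
  have "cinner v (transpose A *v v) = cinner (\<chi> i. cnj (v $ i)) (A *v (\<chi> i. cnj (v $ i)))"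
    by (simp add: cinner_def matrix_vector_mult_def transpose_def sum_distrib_left mult_ac)
      (subst sum.swap, simp add: mult_ac)
  then show "0 \<le> Re (cinner v (transpose A *v v))"
    using assms by (simp add: pos_semidef_def)
qed

lemma pos_semidef_2_entries:
  fixes A :: "complex^2^2"
  assumes "pos_semidef A"
  obtains p r q where "0 \<le> p" "0 \<le> r" "(cmod q)\<^sup>2 \<le> p * r"
    "A = vector [vector [of_real p, q], vector [cnj q, of_real r]]"
proof -
  define p r q where "p = Re (A $ 1 $ 1)" and "r = Re (A $ 2 $ 2)" and "q = A $ 1 $ 2"
  have h: "hermitian A" and pos: "0 \<le> Re (cinner v (A *v v))" for v
    using assms by (auto simp: pos_semidef_def)
  have A11: "A $ 1 $ 1 = of_real p" and A22: "A $ 2 $ 2 = of_real r"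
    using hermitian_cnj[OF h] unfolding p_def r_def by (metis Reals_cnj_iff of_real_Re)+
  have A21: "A $ 2 $ 1 = cnj q"
    using hermitian_cnj[OF h, of 1 2] by (simp add: q_def)
  have form: "Re (cinner (vector [x, y]) (A *v vector [x, y])) =
      p * (cmod x)\<^sup>2 + 2 * Re (cnj x * q * y) + r * (cmod y)\<^sup>2" for x y
    by (simp add: cinner_def matrix_vector_mult_def sum_2 A11 A22 A21 flip: q_def)
      (simp only: cmod_power2, simp add: power2_eq_square algebra_simps)
  have nonneg: "0 \<le> p * (cmod x)\<^sup>2 + 2 * Re (cnj x * q * y) + r * (cmod y)\<^sup>2" for x y
    using pos[of "vector [x, y]"] by (simp add: form)
  have p: "0 \<le> p" and r: "0 \<le> r"
    using nonneg[of 1 0] nonneg[of 0 1] by simp_all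
  \<comment> \<open>The vector \<open>(- q, p)\<close> is annihilated by the first row of the
    matrix, and \<open>(r, - cnj q)\<close> by the second, so each form value is a diagonal entry
    times the determinant.\<close>
  have det_p: "0 \<le> p * (p * r - (cmod q)\<^sup>2)"
    using nonneg[of "- q" "of_real p"]
    unfolding cmod_power2 by (simp add: power2_eq_square algebra_simps)
  have det_r: "0 \<le> r * (p * r - (cmod q)\<^sup>2)"
    using nonneg[of "of_real r" "- cnj q"]
    unfolding cmod_power2 by (simp add: power2_eq_square algebra_simps)
  \<comment> \<open>If \<open>p\<close> and \<open>r\<close> both vanish, the two previous
    inequalities say nothing; the form at \<open>(- q, 1)\<close> is then -2 |q|^2, which forces
    \<open>q = 0\<close>.\<close>
  have det_0: "0 \<le> p * (cmod q)\<^sup>2 - 2 * (cmod q)\<^sup>2 + r"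
    using nonneg[of "- q" 1]
    unfolding cmod_power2 by (simp add: power2_eq_square algebra_simps)
  have "(cmod q)\<^sup>2 \<le> p * r"
  proof (cases "p = 0 \<and> r = 0")
    case True
    then show ?thesis using det_0 by simp
  next
    case False
    then have "0 < p \<or> 0 < r" using p r by linarith
    then show ?thesis using det_p det_r by (auto simp: zero_le_mult_iff)
  qed
  moreover have "A = vector [vector [of_real p, q], vector [cnj q, of_real r]]"
    by (simp add: vec_eq_iff forall_2 A11 A22 A21 q_def)
  ultimately show ?thesis using that p r by blast
qed

text \<open>Cholesky decomposition: for nonzero \<open>p\<close>, one rank-one term reproduces the
  first row and column, and the second carries what is left in the lower corner.\<close>

lemma pos_semidef_2_ket_bra:
  fixes A :: "complex^2^2"
  assumes "pos_semidef A"
  obtains u v where "A = ket_bra u + ket_bra v"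
proof -
  obtain p r q where p: "0 \<le> p" and r: "0 \<le> r" and det: "(cmod q)\<^sup>2 \<le> p * r"
    and A: "A = vector [vector [of_real p, q], vector [cnj q, of_real r]]"
    using pos_semidef_2_entries[OF assms] .
  have sqrt_sq: "complex_of_real (sqrt x) * complex_of_real (sqrt x) = of_real x" if "0 \<le> x" for x
    using that by (simp flip: of_real_mult)
  show thesis
  proof (cases "p = 0")
    case True
    then have "q = 0" using det by simp
    then have "A = ket_bra 0 + ket_bra (vector [0, of_real (sqrt r)])"
      by (simp add: A True ket_bra_def vec_eq_iff forall_2 sqrt_sq r)
    then show thesis by (rule that)
  next
    case False
    \<comment> \<open>The Schur complement of \<open>p\<close>, nonnegative by the determinant
      bound. The first vector contributes |q|^2 / p = \<open>r - s\<close> to the lower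
      corner.\<close>
    define s where "s = r - (cmod q)\<^sup>2 / p"
    have "0 < p" using p False by simp
    then have s: "0 \<le> s" using det by (simp add: s_def field_simps)
    have "cnj q * q = of_real (p * (r - s))"
      using \<open>0 < p\<close> by (simp add: s_def complex_norm_square mult.commute del: of_real_power)
    then have "cnj q / of_real (sqrt p) * (q / of_real (sqrt p)) = of_real (r - s)"
      using \<open>0 < p\<close> sqrt_sq[OF p] by simp
    then have "A = ket_bra (vector [of_real (sqrt p), cnj q / of_real (sqrt p)])
        + ket_bra (vector [0, of_real (sqrt s)])"
      using \<open>0 < p\<close> by (simp add: A ket_bra_def vec_eq_iff forall_2 sqrt_sq p s)
    then show thesis by (rule that)
  qed
qed

section \<open>Positivity on products and the witness criterion\<close>

lemma expval_tensor_nonneg: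
  fixes \<rho> :: "complex^(2 \<times> 2)^(2 \<times> 2)"
  assumes "pos_semidef \<rho>" "pos_semidef A" "pos_semidef B"
  shows "0 \<le> expval \<rho> (A \<otimes> B)"
proof -
  obtain u v where A: "A = ket_bra u + ket_bra v"
    using pos_semidef_2_ket_bra[OF assms(2)] .
  obtain x y where B: "B = ket_bra x + ket_bra y"
    using pos_semidef_2_ket_bra[OF assms(3)] .
  \<comment> \<open>The pairing is the quadratic form of \<open>\<rho>\<close> at a product vector;
    bilinearity then gives \<open>A \<otimes> B\<close> as four such terms.\<close>
  have "0 \<le> expval \<rho> (ket_bra w \<otimes> ket_bra z)" for w z
    using assms(1) by (simp add: tensor_ket_bra pos_semidef_def flip: cinner_eq_expval_ket_bra)
  then show ?thesis
    by (simp add: A B tensor_add_left tensor_add_right expval_add)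
qed

text \<open>Nonnegativity on products extends to separable states by convexity, so the negative
  value at \<open>\<tau>\<close> itself rules out that \<open>\<tau>\<close> is separable.\<close>

lemma entanglement_witnessI:
  assumes "hermitian W" "density_op \<tau>" "expval W \<tau> < 0"
    and product: "\<And>A B. pos_semidef A \<Longrightarrow> pos_semidef B \<Longrightarrow> 0 \<le> expval W (A \<otimes> B)"
  shows "entanglement_witness W \<tau>"
proof -
  have "0 \<le> expval W \<omega>" if "separable \<omega>" for \<omega>
    using that unfolding separable_def
    by (auto simp: expval_sum expval_scaleR density_op_def intro!: sum_nonneg mult_nonneg_nonneg product)
  then show ?thesis
    using assms by (force simp: entanglement_witness_def entangled_def)
qed

section \<open>Partial transposition and partial reduction\<close>

lemma expval_partial_transpose:
  "expval (snd_factor_map transpose X) (A \<otimes> B) = expval X (A \<otimes> transpose B)"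
proof -
  \<comment> \<open>Swapping the second coordinates of the row and column index is an involution on
    index pairs, hence its own inverse in the reindexing.\<close>
  have "(\<Sum>(p, q)\<in>UNIV. X $ (fst p, snd q) $ (fst q, snd p) * (A $ fst q $ fst p * B $ snd q $ snd p)) =
      (\<Sum>(p, q)\<in>UNIV. X $ p $ q * (A $ fst q $ fst p * B $ snd p $ snd q))"
    by (rule sum.reindex_bij_witness[where i = "\<lambda>(p, q). ((fst p, snd q), (fst q, snd p))"
          and j = "\<lambda>(p, q). ((fst p, snd q), (fst q, snd p))"]) auto
  then show ?thesis
    by (simp add: expval_def trace_def matrix_matrix_mult_def snd_factor_map_def op_block_def
        tensor_op_def transpose_def sum.cartesian_product)
qed

lemma hermitian_partial_transpose:
  "hermitian X \<Longrightarrow> hermitian (snd_factor_map transpose X)"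
  by (simp add: hermitian_iff snd_factor_map_def op_block_def transpose_def)

lemma sum_UNIV_2_2: "(\<Sum>p\<in>UNIV. f p) = f (1, 1) + f (1, 2) + f (2, 1) + f (2, 2)"
  for f :: "2 \<times> 2 \<Rightarrow> 'a::comm_monoid_add"
  by (simp add: sum_2 add.assoc sum.cartesian_product' flip: UNIV_Times_UNIV)

text \<open>On each 2 by 2 block both sides give the adjugate: diagonal entries exchanged,
  off-diagonal entries negated.\<close>

lemma partial_reduction_eq_conjugate_partial_transpose:
  fixes X :: "complex^(2 \<times> 2)^(2 \<times> 2)"
  shows "snd_factor_map reduction_map X =
    (mat 1 \<otimes> sigma_y) ** snd_factor_map transpose X ** (mat 1 \<otimes> sigma_y)"
  by (simp add: vec_eq_iff split_paired_all forall_2 snd_factor_map_def op_block_def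
      reduction_map_def transpose_def tensor_op_def matrix_matrix_mult_def sigma_y_def mat_def
      trace_def sum_2 sum_UNIV_2_2 complex_eq_iff)

lemma partial_reduction_eq:
  "snd_factor_map reduction_map X = (reduced_fst X \<otimes> mat 1) - X"
  by (simp add: snd_factor_map_def op_block_def reduction_map_def reduced_fst_def tensor_op_def
      trace_def mat_def vec_eq_iff)

text \<open>The left side is 4 (Tr X1^2 - Tr X^2) with X1 the reduced operator. In the Pauli basis,
  with t = Tr X, 4 Tr X^2 = t^2 + a^2 + b^2 + c^2 and 4 Tr X1^2 = 2 (t^2 + a^2), where a^2, b^2, c^2
  are the three sums of squares. The identity is checked on matrix entries.\<close>

lemma expval_partial_reduction_self:
  fixes X :: "complex^(2 \<times> 2)^(2 \<times> 2)"
  assumes "hermitian X"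
  shows "4 * expval (snd_factor_map reduction_map X) X = (Re (trace X))\<^sup>2
    + (\<Sum>i\<in>UNIV. (expval X (pauli i \<otimes> mat 1))\<^sup>2) - (\<Sum>i\<in>UNIV. (expval X (mat 1 \<otimes> pauli i))\<^sup>2)
    - (\<Sum>i\<in>UNIV. \<Sum>j\<in>UNIV. (expval X (pauli i \<otimes> pauli j))\<^sup>2)"
proof -
  have Re: "Re (X $ q $ p) = Re (X $ p $ q)" and Im: "Im (X $ q $ p) = - Im (X $ p $ q)" for p q
    by (subst hermitian_cnj[OF assms, symmetric], simp)+
  have diag: "Im (X $ p $ p) = 0" for p
    using Im[of p p] by simp
  \<comment> \<open>Oriented instances that express every entry below the diagonal by its mirror
    image, leaving independent real variables for the polynomial identity.\<close>
  note upper = Re[of "(1, 2)" "(1, 1)"] Re[of "(2, 1)" "(1, 1)"] Re[of "(2, 2)" "(1, 1)"]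
    Re[of "(2, 1)" "(1, 2)"] Re[of "(2, 2)" "(1, 2)"] Re[of "(2, 2)" "(2, 1)"]
    Im[of "(1, 2)" "(1, 1)"] Im[of "(2, 1)" "(1, 1)"] Im[of "(2, 2)" "(1, 1)"]
    Im[of "(2, 1)" "(1, 2)"] Im[of "(2, 2)" "(1, 2)"] Im[of "(2, 2)" "(2, 1)"]
  show ?thesis
    by (simp add: expval_def trace_def matrix_matrix_mult_def snd_factor_map_def op_block_def
        reduction_map_def tensor_op_def mat_def pauli_def sigma_x_def sigma_y_def sigma_z_def
        sum_UNIV_2_2 sum_2 sum_3 diag upper)
      (simp add: power2_eq_square algebra_simps)
qed


theorem mainTheorem5:
  fixes \<rho> :: "complex^(2 \<times> 2)^(2 \<times> 2)"
    and a b :: "3 \<Rightarrow> real"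
    and c :: "3 \<Rightarrow> 3 \<Rightarrow> real"
  assumes "density_op \<rho>"
    and "\<And>i. a i = expval \<rho> (pauli i \<otimes> mat 1)"
    and "\<And>i. b i = expval \<rho> (mat 1 \<otimes> pauli i)"
    and "\<And>i j. c i j = expval \<rho> (pauli i \<otimes> pauli j)"
    and "(\<Sum>i\<in>UNIV. \<Sum>j\<in>UNIV. (c i j)\<^sup>2) > 1 - ((\<Sum>i\<in>UNIV. (b i)\<^sup>2) - (\<Sum>i\<in>UNIV. (a i)\<^sup>2))"
  shows "entanglement_witness (snd_factor_map transpose \<rho>)
           ((mat 1 \<otimes> sigma_y) ** \<rho> ** (mat 1 \<otimes> sigma_y)) \<and>
         snd_factor_map reduction_map \<rho> = (reduced_fst \<rho> \<otimes> mat 1) - \<rho> \<and>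
         entanglement_witness (snd_factor_map reduction_map \<rho>) \<rho>"
proof (intro conjI)
  let ?W = "snd_factor_map transpose \<rho>" and ?R = "snd_factor_map reduction_map \<rho>"
  let ?U = "mat 1 \<otimes> sigma_y :: complex^(2 \<times> 2)^(2 \<times> 2)"
  have psd: "pos_semidef \<rho>" and tr: "trace \<rho> = 1"
    using assms(1) by (auto simp: density_op_def)
  then have herm: "hermitian \<rho>"
    by (simp add: pos_semidef_def)
  have sy: "hermitian sigma_y"
    by (simp add: hermitian_iff sigma_y_def forall_2)
  have U: "hermitian ?U"
    using sy by (simp add: hermitian_iff tensor_op_def mat_def)
  have "sigma_y ** sigma_y = mat 1"
    by (simp add: sigma_y_def matrix_matrix_mult_def mat_def vec_eq_iff forall_2 sum_2)
  then have UU: "?U ** ?U = mat 1"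
    by (simp add: tensor_mult mat_tensor_mat)
  have R: "?R = ?U ** ?W ** ?U"
    by (rule partial_reduction_eq_conjugate_partial_transpose)
  have W: "hermitian ?W"
    using herm by (rule hermitian_partial_transpose)
  have W_product: "0 \<le> expval ?W (A \<otimes> B)" if "pos_semidef A" "pos_semidef B" for A B
    using that by (simp add: expval_partial_transpose expval_tensor_nonneg psd pos_semidef_transpose)
  \<comment> \<open>Cyclicity moves the conjugation by \<open>sigma_y\<close> onto \<open>B\<close>,
    which stays positive.\<close>
  have R_product: "0 \<le> expval ?R (A \<otimes> B)" if "pos_semidef A" "pos_semidef B" for A B
    using that by (simp add: R expval_conjugate tensor_mult W_product pos_semidef_conjugate sy)
  have "trace (?U ** (\<rho> ** ?U)) = trace \<rho>"
    by (subst trace_mul_sym) (simp add: UU flip: matrix_mul_assoc)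
  then have \<tau>: "density_op (?U ** \<rho> ** ?U)"
    using psd tr by (simp add: density_op_def pos_semidef_conjugate U matrix_mul_assoc)
  have neg: "expval ?R \<rho> < 0"
    using expval_partial_reduction_self[OF herm] assms(5) by (simp add: tr flip: assms(2-4))
  \<comment> \<open>By cyclicity \<open>?U\<close> passes from the operator to the state: both
    witnesses take the same value at their respective states.\<close>
  then have "expval ?W (?U ** \<rho> ** ?U) < 0"
    by (simp add: R expval_conjugate)
  with W \<tau> show "entanglement_witness ?W (?U ** \<rho> ** ?U)"
    using W_product by (rule entanglement_witnessI)
  show "?R = (reduced_fst \<rho> \<otimes> mat 1) - \<rho>"
    by (rule partial_reduction_eq)
  have "hermitian ?R"
    using U W by (simp add: R hermitian_def adjoint_mat_mult matrix_mul_assoc)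
  then show "entanglement_witness ?R \<rho>"
    using assms(1) neg R_product by (rule entanglement_witnessI)
qed

end
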